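(* For any topological gyrogroup $G$, the space $G^\bullet$ is path-connected and locally path-connected.
   Context: A gyrogroup is a nonempty set $G$ with a binary operation $\oplus$ such that: (G1) there is $e\in G$ with $e\oplus x=x=x\oplus e$ for all $x$; (G2) each $x\in G$ has an inverse $\ominus x\in G$ with $\ominus x\oplus x=e=x\oplus(\ominus x)$; (G3) for all $x,y\in G$ there is an automorphism $\mathrm{gyr}[x,y]$ of $(G,\oplus)$ such that $x\oplus(y\oplus z)=(x\oplus y)\oplus\mathrm{gyr}[x,y](z)$ for all $z\in G$; (G4) $\mathrm{gyr}[x\oplus y,y]=\mathrm{gyr}[x,y]$ for all $x,y\in G$. A topological gyrogroup is a gyrogroup $G$ with a topology such that $\oplus:G\times G\to G$ (product topology on $G\times G$) and $x\mapsto\ominus x$ are continuous. No separation axiom is assumed. Let $J=[0,1)$. A function $f:J\to G$ is a step function if there are reals $0=a_0<a_1<\dots<a_n=1$ such that $f$ is constant on $[a_k,a_{k+1})$ for $k=0,\dots,n-1$. $G^\bullet$ denotes the set of all step functions $J\to G$ with the pointwise operation $(f\oplus g)(r)=f(r)\oplus g(r)$; it is known that $G^\bullet$ is a gyrogroup. For an open neighborhood $U$ of $e$ in $G$ and $\varepsilon>0$, put $O(U,\varepsilon)=\{f\in G^\bullet : \mu(\{r\in J : f(r)\notin U\})<\varepsilon\}$, where $\mu$ is Lebesgue measure. $G^\bullet$ carries the topology with base $\{f\oplus O(U,\varepsilon) : f\in G^\bullet,\ U\in\mathcal{U},\ \varepsilon>0\}$, where $\mathcal{U}$ is an open base at $e$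 in $G$ and $f\oplus O(U,\varepsilon)=\{f\oplus g : g\in O(U,\varepsilon)\}$; with it $G^\bullet$ is a topological gyrogroup. *)

theory Defs
  imports "HOL-Analysis.Analysis"
begin

text \<open>The identity, the inverse and the gyrations are determined on \<open>G\<close> by the operation, so
  carrying them as locale parameters loses no generality. Outside the carrier all operations are
  unconstrained.\<close>

locale gyrogroup =
  fixes G :: "'a set"
    and add :: "'a \<Rightarrow> 'a \<Rightarrow> 'a" (infixl \<open>\<oplus>\<close> 65)
    and e :: 'a
    and inv :: "'a \<Rightarrow> 'a" (\<open>\<ominus> _\<close> [81] 80)
    and gyr :: "'a \<Rightarrow> 'a \<Rightarrow> 'a \<Rightarrow> 'a"
  assumes add_closed: "\<And>x y. x \<in> G \<Longrightarrow> y \<in> G \<Longrightarrow> x \<oplus> y \<in> G"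
    and id_closed: "e \<in> G"
    and id_left: "\<And>x. x \<in> G \<Longrightarrow> e \<oplus> x = x"
    and id_right: "\<And>x. x \<in> G \<Longrightarrow> x \<oplus> e = x"
    and inv_closed: "\<And>x. x \<in> G \<Longrightarrow> \<ominus> x \<in> G"
    and inv_left: "\<And>x. x \<in> G \<Longrightarrow> \<ominus> x \<oplus> x = e"
    and inv_right: "\<And>x. x \<in> G \<Longrightarrow> x \<oplus> \<ominus> x = e"
    and gyr_bij: "\<And>x y. x \<in> G \<Longrightarrow> y \<in> G \<Longrightarrow> bij_betw (gyr x y) G G"
    and gyr_hom: "\<And>x y u v. x \<in> G \<Longrightarrow> y \<in> G \<Longrightarrow> u \<in> G \<Longrightarrow> v \<in> G \<Longrightarrow>
        gyr x y (u \<oplus> v) = gyr x y u \<oplus> gyr x y v"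
    and gyr_assoc: "\<And>x y z. x \<in> G \<Longrightarrow> y \<in> G \<Longrightarrow> z \<in> G \<Longrightarrow>
        x \<oplus> (y \<oplus> z) = (x \<oplus> y) \<oplus> gyr x y z"
    and gyr_loop: "\<And>x y z. x \<in> G \<Longrightarrow> y \<in> G \<Longrightarrow> z \<in> G \<Longrightarrow> gyr (x \<oplus> y) y z = gyr x y z"

locale topological_gyrogroup = gyrogroup +
  fixes T :: "'a topology"
  assumes topspace_eq: "topspace T = G"
    and continuous_add: "continuous_map (prod_topology T T) T (\<lambda>(x, y). x \<oplus> y)"
    and continuous_inv: "continuous_map T T (\<lambda>x. \<ominus> x)"

definition open_base_at :: "'a topology \<Rightarrow> 'a \<Rightarrow> 'a set set \<Rightarrow> bool" where
  "open_base_at T x \<U> \<longleftrightarrow>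
     (\<forall>U\<in>\<U>. openin T U \<and> x \<in> U) \<and>
     (\<forall>V. openin T V \<and> x \<in> V \<longrightarrow> (\<exists>U\<in>\<U>. U \<subseteq> V))"

abbreviation J :: "real set" where "J \<equiv> {0..<1}"

text \<open>Functions \<open>J \<rightarrow> G\<close> are extensional (equal to \<open>undefined\<close> off \<open>J\<close>), so that equality of
  step functions is equality on \<open>J\<close>.\<close>

definition step_functions :: "'a set \<Rightarrow> (real \<Rightarrow> 'a) set" where
  "step_functions G = {f \<in> J \<rightarrow>\<^sub>E G. \<exists>(n::nat) (a::nat \<Rightarrow> real). a 0 = 0 \<and> a n = 1 \<and>
      (\<forall>k<n. a k < a (Suc k)) \<and> (\<forall>k<n. f constant_on {a k..<a (Suc k)})}"

definition step_add :: "('a \<Rightarrow> 'a \<Rightarrow> 'a) \<Rightarrow> (real \<Rightarrow> 'a) \<Rightarrow> (real \<Rightarrow> 'a) \<Rightarrow> real \<Rightarrow> 'a" where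
  "step_add add f g = (\<lambda>r\<in>J. add (f r) (g r))"

definition step_nbhd :: "'a set \<Rightarrow> 'a set \<Rightarrow> real \<Rightarrow> (real \<Rightarrow> 'a) set" where
  "step_nbhd G U \<epsilon> = {f \<in> step_functions G. measure lebesgue {r \<in> J. f r \<notin> U} < \<epsilon>}"

definition step_base :: "'a set \<Rightarrow> ('a \<Rightarrow> 'a \<Rightarrow> 'a) \<Rightarrow> 'a set set \<Rightarrow> (real \<Rightarrow> 'a) set set" where
  "step_base G add \<U> =
     {step_add add f ` step_nbhd G U \<epsilon> | f U \<epsilon>. f \<in> step_functions G \<and> U \<in> \<U> \<and> 0 < \<epsilon>}"

text \<open>That the unions of members of the base form a topology, as the constructor \<open>topology\<close>
  requires, is shown in \<open>istopology_step_base\<close> below.\<close>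

definition step_topology :: "'a set \<Rightarrow> ('a \<Rightarrow> 'a \<Rightarrow> 'a) \<Rightarrow> 'a set set \<Rightarrow> (real \<Rightarrow> 'a) topology" where
  "step_topology G add \<U> = topology (arbitrary union_of (\<lambda>B. B \<in> step_base G add \<U>))"

context gyrogroup
begin

lemma left_cancel_eq:
  assumes "a \<in> G" "b \<in> G" "c \<in> G" "a \<oplus> b = a \<oplus> c" shows "b = c"
proof -
  have "gyr (\<ominus> a) a b = gyr (\<ominus> a) a c"
    using gyr_assoc[of "\<ominus> a" a b] gyr_assoc[of "\<ominus> a" a c] assms
      bij_betwE[OF gyr_bij[of "\<ominus> a" a]]
    by (simp add: inv_closed inv_left id_left)
  then show ?thesis
    using gyr_bij[of "\<ominus> a" a] assms by (auto simp: inv_closed bij_betw_def inj_on_def)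
qed

lemma inv_add_cancel:
  assumes "a \<in> G" "b \<in> G" shows "\<ominus> a \<oplus> (a \<oplus> b) = b"
proof -
  have g: "gyr e a b \<in> G" using bij_betwE[OF gyr_bij[of e a]] assms id_closed by auto
  have "a \<oplus> b = a \<oplus> gyr e a b"
    using gyr_assoc[of e a b] assms by (simp add: id_closed id_left add_closed)
  then have "gyr e a b = b" using left_cancel_eq[of a b "gyr e a b"] g assms by simp
  moreover have "gyr (\<ominus> a) a b = gyr e a b"
    using gyr_loop[of "\<ominus> a" a b] assms by (simp add: inv_closed inv_left)
  ultimately show ?thesis
    using gyr_assoc[of "\<ominus> a" a b] assms by (simp add: inv_closed inv_left id_left)
qed

lemma add_inv_cancel:
  assumes "a \<in> G" "b \<in> G" shows "a \<oplus> (\<ominus> a \<oplus> b) = b"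
  using left_cancel_eq[of "\<ominus> a" "a \<oplus> (\<ominus> a \<oplus> b)" b] inv_add_cancel[of a "\<ominus> a \<oplus> b"] assms
  by (simp add: add_closed inv_closed)

end

lemma partition_cover:
  fixes a :: "nat \<Rightarrow> real"
  assumes "a 0 = 0" "a n = 1" "x \<in> J"
  obtains k where "k < n" "x \<in> {a k..<a (Suc k)}"
proof -
  define m where "m = (LEAST m. x < a m)"
  have m: "x < a m" unfolding m_def by (rule LeastI[of _ n]) (use assms in auto)
  have "m \<le> n" unfolding m_def by (rule Least_le) (use assms in auto)
  have "m \<noteq> 0" using m assms by (metis atLeastLessThan_iff not_less)
  then obtain k where k: "m = Suc k" by (cases m) auto
  have "a k \<le> x" using not_less_Least[of k "\<lambda>m. x < a m"] k by (auto simp: m_def)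
  then show thesis using that[of k] k m \<open>m \<le> n\<close> by auto
qed

text \<open>Finite sets of break points combine more easily than increasing sequences.\<close>

lemma step_functions_iff:
  "f \<in> step_functions G \<longleftrightarrow> f \<in> J \<rightarrow>\<^sub>E G \<and>
     (\<exists>A. finite A \<and> (\<forall>x\<in>J. \<forall>y\<in>J. x < y \<and> A \<inter> {x<..y} = {} \<longrightarrow> f x = f y))"
  (is "?L \<longleftrightarrow> ?R")
proof
  assume ?L
  then obtain n :: nat and a :: "nat \<Rightarrow> real" where f: "f \<in> J \<rightarrow>\<^sub>E G"
    and a: "a 0 = 0" "a n = 1" and c: "\<forall>k<n. f constant_on {a k..<a (Suc k)}"
    by (auto simp: step_functions_def)
  have "f x = f y" if xy: "x \<in> J" "y \<in> J" "x < y" "a ` {..n} \<inter> {x<..y} = {}" for x y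
  proof -
    obtain k where k: "k < n" "x \<in> {a k..<a (Suc k)}"
      using partition_cover[OF a \<open>x \<in> J\<close>] .
    then have "a (Suc k) \<in> a ` {..n}" by auto
    then have "y < a (Suc k)" using k xy by (metis IntI atLeastLessThan_iff empty_iff
          greaterThanAtMost_iff not_less)
    then have "y \<in> {a k..<a (Suc k)}" using k xy by auto
    then show ?thesis using c k unfolding constant_on_def by metis
  qed
  moreover have "finite (a ` {..n})" by simp
  ultimately show ?R using f by blast
next
  assume ?R
  then obtain A where f: "f \<in> J \<rightarrow>\<^sub>E G" and A: "finite A"
    and const: "\<And>x y. x \<in> J \<Longrightarrow> y \<in> J \<Longrightarrow> x < y \<Longrightarrow> A \<inter> {x<..y} = {} \<Longrightarrow> f x = f y"
    by blast
  define B where "B = insert 0 (insert 1 (A \<inter> {0<..<1}))"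
  define l where "l = sorted_list_of_set B"
  define n where "n = length l - 1"
  have finB: "finite B" using A by (simp add: B_def)
  have setl: "set l = B" using finB by (simp add: l_def)
  have sl: "sorted_wrt (<) l" by (simp add: l_def)
  have B01: "B \<subseteq> {0..1}" "0 \<in> B" "1 \<in> B" by (auto simp: B_def)
  have ne: "l \<noteq> []" using setl B01 by auto
  have ln: "length l = Suc n" using ne by (simp add: n_def)
  have less: "l ! i < l ! j" if "i < j" "j \<le> n" for i j
    using sorted_wrt_nth_less[OF sl] that ln by auto
  have leq: "l ! i \<le> l ! j" if "i \<le> j" "j \<le> n" for i j
    using less[of i j] that by (cases "i = j") auto
  have idx: "\<exists>i\<le>n. l ! i = b" if "b \<in> B" for b
    using that setl ln by (metis in_set_conv_nth less_Suc_eq_le)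
  have inB: "l ! i \<in> B" if "i \<le> n" for i using that setl ln by (metis nth_mem less_Suc_eq_le)
  have l0: "l ! 0 = 0"
    using idx[OF B01(2)] leq[of 0] inB[of 0] B01(1)
    by (smt (verit) atLeastAtMost_iff le0 subset_iff)
  have l1: "l ! n = 1"
    using idx[OF B01(3)] leq[of _ n] inB[of n] B01(1)
    by (smt (verit) atLeastAtMost_iff order_refl subset_iff)
  have "f constant_on {l ! k..<l ! Suc k}" if k: "k < n" for k
  proof -
    have lk: "l ! k \<in> {0..1}" "l ! Suc k \<in> {0..1}"
      using inB[of k] inB[of "Suc k"] k B01(1) by auto
    have "f (l ! k) = f y" if y: "y \<in> {l ! k..<l ! Suc k}" for y
    proof (cases "y = l ! k")
      case False
      have "b \<notin> {l ! k<..y}" if "b \<in> A" for b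
      proof
        assume b: "b \<in> {l ! k<..y}"
        then have "b \<in> B" using that lk y by (auto simp: B_def)
        then obtain i where i: "i \<le> n" "l ! i = b" using idx by blast
        have "k < i" using leq[of i k] i b k by (auto simp: not_less[symmetric])
        then have "l ! Suc k \<le> b" using leq[of "Suc k" i] i by auto
        then show False using b y by auto
      qed
      then have "A \<inter> {l ! k<..y} = {}" by blast
      moreover have "l ! k \<in> J" "y \<in> J" "l ! k < y" using lk y False by auto
      ultimately show ?thesis using const[of "l ! k" y] by blast
    qed auto
    then show ?thesis unfolding constant_on_def by metis
  qed
  then show ?L using f l0 l1 less
    unfolding step_functions_def by (auto intro!: exI[of _ n] exI[of _ "\<lambda>k. l ! k"])
qed

lemma step_map2:
  assumes f: "f \<in> step_functions G" and g: "g \<in> step_functions H"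
    and F: "\<And>x y. x \<in> G \<Longrightarrow> y \<in> H \<Longrightarrow> F x y \<in> K"
  shows "(\<lambda>r\<in>J. F (f r) (g r)) \<in> step_functions K"
proof -
  obtain A where A: "finite A" "\<And>x y. x \<in> J \<Longrightarrow> y \<in> J \<Longrightarrow> x < y \<Longrightarrow> A \<inter> {x<..y} = {} \<Longrightarrow> f x = f y"
    using f by (auto simp: step_functions_iff)
  obtain B where B: "finite B" "\<And>x y. x \<in> J \<Longrightarrow> y \<in> J \<Longrightarrow> x < y \<Longrightarrow> B \<inter> {x<..y} = {} \<Longrightarrow> g x = g y"
    using g by (auto simp: step_functions_iff)
  have "f r \<in> G" "g r \<in> H" if "r \<in> J" for r
    using f g that by (auto simp: step_functions_iff)
  then have "(\<lambda>r\<in>J. F (f r) (g r)) \<in> J \<rightarrow>\<^sub>E K" using F by auto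
  moreover have "\<forall>x\<in>J. \<forall>y\<in>J. x < y \<and> (A \<union> B) \<inter> {x<..y} = {} \<longrightarrow>
      (\<lambda>r\<in>J. F (f r) (g r)) x = (\<lambda>r\<in>J. F (f r) (g r)) y"
  proof (intro ballI impI)
    fix x y assume xy: "x \<in> J" "y \<in> J" "x < y \<and> (A \<union> B) \<inter> {x<..y} = {}"
    then have "f x = f y" "g x = g y" using A(2)[of x y] B(2)[of x y] by blast+
    then show "(\<lambda>r\<in>J. F (f r) (g r)) x = (\<lambda>r\<in>J. F (f r) (g r)) y" using xy by simp
  qed
  ultimately show ?thesis using A(1) B(1) unfolding step_functions_iff by (meson finite_UnI)
qed

lemma step_functions_decomp:
  assumes "f \<in> step_functions G"
  obtains n :: nat and a :: "nat \<Rightarrow> real" where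
    "\<And>x. x \<in> J \<longleftrightarrow> (\<exists>k<n. x \<in> {a k..<a (Suc k)})"
    "\<And>k x. k < n \<Longrightarrow> x \<in> {a k..<a (Suc k)} \<Longrightarrow> f x = f (a k)"
proof -
  obtain n :: nat and a :: "nat \<Rightarrow> real" where
    a: "a 0 = 0" "a n = 1" and less: "\<forall>k<n. a k < a (Suc k)"
    and c: "\<forall>k<n. f constant_on {a k..<a (Suc k)}"
    using assms by (auto simp: step_functions_def)
  have mono: "a i \<le> a j" if "i \<le> j" "j \<le> n" for i j
    using that
  proof (induction j rule: dec_induct)
    case (step j)
    then show ?case using less by (smt (verit) Suc_le_eq less_imp_le_nat)
  qed simp
  have "x \<in> J \<longleftrightarrow> (\<exists>k<n. x \<in> {a k..<a (Suc k)})" for x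
  proof
    assume "x \<in> J" then show "\<exists>k<n. x \<in> {a k..<a (Suc k)}" using partition_cover[OF a] by metis
  next
    assume "\<exists>k<n. x \<in> {a k..<a (Suc k)}"
    then obtain k where k: "k < n" "x \<in> {a k..<a (Suc k)}" by blast
    then show "x \<in> J" using mono[of 0 k] mono[of "Suc k" n] a by auto
  qed
  moreover have "f x = f (a k)" if k: "k < n" and x: "x \<in> {a k..<a (Suc k)}" for k x
  proof -
    have "a k \<in> {a k..<a (Suc k)}" using less k by simp
    then show ?thesis using x k c unfolding constant_on_def by metis
  qed
  ultimately show thesis using that by blast
qed

lemma finite_step_image:
  assumes "f \<in> step_functions G" shows "finite (f ` J)"
proof -
  obtain n :: nat and a :: "nat \<Rightarrow> real" where
    1: "\<And>x. x \<in> J \<longleftrightarrow> (\<exists>k<n. x \<in> {a k..<a (Suc k)})" and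
    2: "\<And>k x. k < n \<Longrightarrow> x \<in> {a k..<a (Suc k)} \<Longrightarrow> f x = f (a k)"
    using step_functions_decomp[OF assms] by metis
  have "f ` J \<subseteq> (\<lambda>k. f (a k)) ` {..<n}"
  proof (rule image_subsetI)
    fix x assume "x \<in> J"
    then obtain k where "k < n" "x \<in> {a k..<a (Suc k)}" using 1 by blast
    then show "f x \<in> (\<lambda>k. f (a k)) ` {..<n}" using 2 by blast
  qed
  then show ?thesis by (meson finite_imageI finite_lessThan finite_subset)
qed

lemma step_bad_lmeasurable:
  assumes "f \<in> step_functions G" shows "{r \<in> J. f r \<notin> U} \<in> lmeasurable"
proof -
  obtain n :: nat and a :: "nat \<Rightarrow> real" where
    1: "\<And>x. x \<in> J \<longleftrightarrow> (\<exists>k<n. x \<in> {a k..<a (Suc k)})" and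
    2: "\<And>k x. k < n \<Longrightarrow> x \<in> {a k..<a (Suc k)} \<Longrightarrow> f x = f (a k)"
    using step_functions_decomp[OF assms] by metis
  have eq: "{r \<in> J. f r \<notin> U} = (\<Union>k\<in>{k. k < n \<and> f (a k) \<notin> U}. {a k..<a (Suc k)})" (is "?L = ?R")
  proof (intro set_eqI iffI)
    fix x assume x: "x \<in> ?L"
    then have "x \<in> J" "f x \<notin> U" by simp_all
    then obtain k where k: "k < n" "x \<in> {a k..<a (Suc k)}" using 1[of x] by blast
    then have "f (a k) \<notin> U" using 2[of k x] \<open>f x \<notin> U\<close> by simp
    then show "x \<in> ?R" using k by blast
  next
    fix x assume "x \<in> ?R"
    then obtain k where k: "k < n" "f (a k) \<notin> U" "x \<in> {a k..<a (Suc k)}" by blast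
    then have "f x = f (a k)" using 2[of k x] by simp
    moreover have "x \<in> J" using k 1[of x] by blast
    ultimately have "f x \<notin> U \<and> x \<in> J" using k by simp
    then show "x \<in> ?L" by blast
  qed
  have "?R \<in> sets lebesgue" by (intro sets.finite_UN) auto
  then have "?L \<in> sets lebesgue" by (simp only: eq)
  moreover have "bounded ?L" by (rule bounded_subset[of "{0..1}"]) auto
  ultimately show ?thesis by (intro bounded_set_imp_lmeasurable)
qed

context topological_gyrogroup
begin

lemma step_base_refine:
  assumes f: "f \<in> step_functions G" and U: "openin T U" and \<U>: "open_base_at T e \<U>"
    and h: "h \<in> step_add add f ` step_nbhd G U \<epsilon>"
  shows "\<exists>V\<in>\<U>. \<exists>\<delta>>0. step_add add h ` step_nbhd G V \<delta> \<subseteq> step_add add f ` step_nbhd G U \<epsilon>"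
proof -
  obtain g where g: "g \<in> step_functions G" "measure lebesgue {r \<in> J. g r \<notin> U} < \<epsilon>"
    and h_eq: "h = step_add add f g"
    using h by (auto simp: step_nbhd_def)
  have hs: "h \<in> step_functions G"
    unfolding h_eq step_add_def by (rule step_map2[OF f g(1)]) (rule add_closed)
  have in_G: "f r \<in> G" "g r \<in> G" "h r \<in> G" if "r \<in> J" for r
    using f g(1) hs that by (auto simp: step_functions_iff)
  define Q where "Q = {(p, q) \<in> f ` J \<times> h ` J. \<ominus> p \<oplus> q \<in> U}"
  define N where "N = (\<lambda>(p, q). {z \<in> topspace T. \<ominus> p \<oplus> (q \<oplus> z) \<in> U})"
  have finQ: "finite Q"
    by (rule finite_subset[of _ "f ` J \<times> h ` J"])
       (auto simp: Q_def finite_step_image[OF f] finite_step_image[OF hs])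
  have trans: "continuous_map T T (\<lambda>z. p \<oplus> k z)"
    if "p \<in> G" "continuous_map T T k" for p k
  proof -
    have "continuous_map T (prod_topology T T) (\<lambda>z. (p, k z))"
      using that by (simp add: continuous_map_pairwise o_def topspace_eq)
    then show ?thesis
      using continuous_map_compose[OF _ continuous_add] by (fastforce simp: o_def)
  qed
  have N: "openin T (N pq) \<and> e \<in> N pq" if pq_in: "pq \<in> Q" for pq
  proof -
    obtain p q where pq: "pq = (p, q)" "p \<in> G" "q \<in> G" "\<ominus> p \<oplus> q \<in> U"
      using pq_in in_G unfolding Q_def by blast
    have "continuous_map T T (\<lambda>z. \<ominus> p \<oplus> (q \<oplus> z))"
      using pq by (intro trans) (auto simp: inv_closed)
    then have "openin T (N pq)"
      using U openin_continuous_map_preimage pq(1) by (fastforce simp: N_def)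
    then show ?thesis using pq id_closed by (simp add: N_def id_right topspace_eq)
  qed
  have "openin T (topspace T \<inter> \<Inter> (N ` Q))"
    by (cases "Q = {}") (use finQ N in \<open>auto intro!: openin_Int openin_Inter\<close>)
  moreover have "e \<in> topspace T \<inter> \<Inter> (N ` Q)" using N id_closed topspace_eq by auto
  ultimately obtain V where V: "V \<in> \<U>" "V \<subseteq> topspace T \<inter> \<Inter> (N ` Q)"
    using \<U> unfolding open_base_at_def by meson
  define \<delta> where "\<delta> = \<epsilon> - measure lebesgue {r \<in> J. g r \<notin> U}"
  have "\<delta> > 0" using g(2) by (simp add: \<delta>_def)
  moreover have "step_add add h k \<in> step_add add f ` step_nbhd G U \<epsilon>"
    if "k \<in> step_nbhd G V \<delta>" for k
  proof -
    have k: "k \<in> step_functions G" "measure lebesgue {r \<in> J. k r \<notin> V} < \<delta>"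
      using that by (auto simp: step_nbhd_def)
    have kG: "k r \<in> G" if "r \<in> J" for r using k(1) that by (auto simp: step_functions_iff)
    define w where "w = (\<lambda>r\<in>J. \<ominus> f r \<oplus> step_add add h k r)"
    have hk: "step_add add h k \<in> step_functions G"
      unfolding step_add_def by (rule step_map2[OF hs k(1)]) (rule add_closed)
    have ws: "w \<in> step_functions G"
      unfolding w_def by (rule step_map2[OF f hk]) (intro add_closed inv_closed)
    have fw: "step_add add f w = step_add add h k"
      using in_G kG by (auto simp: step_add_def w_def fun_eq_iff add_inv_cancel add_closed)
    have "{r \<in> J. w r \<notin> U} \<subseteq> {r \<in> J. g r \<notin> U} \<union> {r \<in> J. k r \<notin> V}"
    proof (rule subsetI, rule ccontr)
      fix r assume r: "r \<in> {r \<in> J. w r \<notin> U}" "r \<notin> {r \<in> J. g r \<notin> U} \<union> {r \<in> J. k r \<notin> V}"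
      then have rJ: "r \<in> J" and *: "w r \<notin> U" "g r \<in> U" "k r \<in> V" by auto
      have "\<ominus> f r \<oplus> h r = g r"
        using rJ in_G[OF rJ] by (simp add: h_eq step_add_def inv_add_cancel)
      then have "(f r, h r) \<in> Q" using rJ * by (simp add: Q_def)
      then have "k r \<in> N (f r, h r)" using V * by blast
      then show False using * rJ by (simp add: N_def w_def step_add_def)
    qed
    then have "measure lebesgue {r \<in> J. w r \<notin> U}
        \<le> measure lebesgue ({r \<in> J. g r \<notin> U} \<union> {r \<in> J. k r \<notin> V})"
      using step_bad_lmeasurable[OF g(1)] step_bad_lmeasurable[OF k(1)]
        step_bad_lmeasurable[OF ws]
      by (intro measure_mono_fmeasurable fmeasurable.Un fmeasurableD)
    also have "\<dots> \<le> measure lebesgue {r \<in> J. g r \<notin> U} + measure lebesgue {r \<in> J. k r \<notin> V}"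
      using step_bad_lmeasurable[OF g(1)] step_bad_lmeasurable[OF k(1)]
      by (intro measure_Un_le fmeasurableD)
    also have "\<dots> < \<epsilon>" using k(2) by (simp add: \<delta>_def)
    finally have "w \<in> step_nbhd G U \<epsilon>" using ws by (simp add: step_nbhd_def)
    then show ?thesis using fw by (metis imageI)
  qed
  ultimately show ?thesis using V(1) by blast
qed

lemma step_nbhd_mono:
  assumes "V \<subseteq> U" "\<delta> \<le> \<epsilon>" shows "step_nbhd G V \<delta> \<subseteq> step_nbhd G U \<epsilon>"
proof
  fix f assume f: "f \<in> step_nbhd G V \<delta>"
  then have fs: "f \<in> step_functions G" by (simp add: step_nbhd_def)
  have "measure lebesgue {r \<in> J. f r \<notin> U} \<le> measure lebesgue {r \<in> J. f r \<notin> V}"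
    using assms(1) step_bad_lmeasurable[OF fs] by (intro measure_mono_fmeasurable fmeasurableD) auto
  then show "f \<in> step_nbhd G U \<epsilon>" using f assms(2) by (simp add: step_nbhd_def)
qed

lemma step_centre:
  assumes "h \<in> step_functions G" "e \<in> V" "0 < \<delta>"
  shows "h \<in> step_add add h ` step_nbhd G V \<delta>"
proof (rule image_eqI)
  have hr: "h r \<in> G" if "r \<in> J" for r using assms(1) that by (auto simp: step_functions_iff)
  have ext: "h \<in> extensional J" using assms(1) by (auto simp: step_functions_iff PiE_def)
  show "h = step_add add h (\<lambda>r\<in>J. e)"
    using hr ext by (auto simp: step_add_def fun_eq_iff id_right extensional_def)
  have "(\<lambda>r\<in>J. e) \<in> step_functions G"
    by (rule step_map2[OF assms(1) assms(1), where F = "\<lambda>_ _. e"]) (rule id_closed)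
  moreover have bad: "{r \<in> J. (\<lambda>r\<in>J. e) r \<notin> V} = {}" using assms(2) by auto
  ultimately show "(\<lambda>r\<in>J. e) \<in> step_nbhd G V \<delta>"
    using assms(3) unfolding step_nbhd_def mem_Collect_eq bad by simp
qed

lemma step_base_subset:
  assumes "B \<in> step_base G add \<U>" shows "B \<subseteq> step_functions G"
proof -
  have "step_add add f g \<in> step_functions G"
    if "f \<in> step_functions G" "g \<in> step_functions G" for f g
    unfolding step_add_def by (rule step_map2[OF that]) (rule add_closed)
  then show ?thesis using assms by (auto simp: step_base_def step_nbhd_def)
qed

lemma istopology_step_base:
  assumes \<U>: "open_base_at T e \<U>"
  shows "istopology (arbitrary union_of (\<lambda>B. B \<in> step_base G add \<U>))"
  unfolding istopology_base_eq
proof (intro allI impI)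
  fix B C assume BC: "B \<in> step_base G add \<U> \<and> C \<in> step_base G add \<U>"
  have "\<exists>D. D \<in> step_base G add \<U> \<and> h \<in> D \<and> D \<subseteq> B \<inter> C" if h: "h \<in> B \<inter> C" for h
  proof -
    have hs: "h \<in> step_functions G" using step_base_subset BC h by blast
    have refine: "\<exists>V\<in>\<U>. \<exists>\<delta>>0. step_add add h ` step_nbhd G V \<delta> \<subseteq> X"
      if X: "X \<in> step_base G add \<U>" "h \<in> X" for X
    proof -
      obtain f U \<epsilon> where "X = step_add add f ` step_nbhd G U \<epsilon>" "f \<in> step_functions G" "U \<in> \<U>"
        using X(1) by (auto simp: step_base_def)
      then show ?thesis
        using step_base_refine[OF _ _ \<U>] X(2) \<U> by (auto simp: open_base_at_def)
    qed
    obtain V \<delta> where V: "V \<in> \<U>" "\<delta> > 0" "step_add add h ` step_nbhd G V \<delta> \<subseteq> B"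
      using refine[of B] BC h by blast
    obtain W \<eta> where W: "W \<in> \<U>" "\<eta> > 0" "step_add add h ` step_nbhd G W \<eta> \<subseteq> C"
      using refine[of C] BC h by blast
    have "openin T (V \<inter> W) \<and> e \<in> V \<inter> W" using \<U> V W by (auto simp: open_base_at_def)
    then obtain Y where Y: "Y \<in> \<U>" "Y \<subseteq> V \<inter> W" using \<U> by (auto simp: open_base_at_def)
    define \<theta> where "\<theta> = min \<delta> \<eta>"
    have \<theta>: "\<theta> > 0" "\<theta> \<le> \<delta>" "\<theta> \<le> \<eta>" using V W by (auto simp: \<theta>_def)
    have "step_add add h ` step_nbhd G Y \<theta> \<subseteq> B \<inter> C"
      using step_nbhd_mono[of Y V \<theta> \<delta>] step_nbhd_mono[of Y W \<theta> \<eta>] Y \<theta> V W by blast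
    moreover have "h \<in> step_add add h ` step_nbhd G Y \<theta>"
      using step_centre[OF hs] Y \<U> \<theta> by (auto simp: open_base_at_def)
    moreover have "step_add add h ` step_nbhd G Y \<theta> \<in> step_base G add \<U>"
      using hs Y \<theta> by (auto simp: step_base_def)
    ultimately show ?thesis by blast
  qed
  then show "(arbitrary union_of (\<lambda>B. B \<in> step_base G add \<U>)) (B \<inter> C)"
    by (auto simp: arbitrary_union_of_alt)
qed

lemma openin_step_topology:
  assumes "open_base_at T e \<U>"
  shows "openin (step_topology G add \<U>) W \<longleftrightarrow>
    (arbitrary union_of (\<lambda>B. B \<in> step_base G add \<U>)) W"
  using topology_inverse'[OF istopology_step_base[OF assms]] by (simp add: step_topology_def)

lemma topspace_step_topology:
  assumes \<U>: "open_base_at T e \<U>"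
  shows "topspace (step_topology G add \<U>) = step_functions G"
proof
  show "topspace (step_topology G add \<U>) \<subseteq> step_functions G"
  proof -
    have "(arbitrary union_of (\<lambda>B. B \<in> step_base G add \<U>)) (topspace (step_topology G add \<U>))"
      using openin_topspace openin_step_topology[OF \<U>] by metis
    then obtain \<B> where "\<B> \<subseteq> step_base G add \<U>" "\<Union> \<B> = topspace (step_topology G add \<U>)"
      unfolding union_of_def arbitrary_def by auto
    then show ?thesis using step_base_subset by blast
  qed
  obtain V where V: "V \<in> \<U>" "e \<in> V"
    using \<U> id_closed openin_topspace[of T] unfolding open_base_at_def topspace_eq by metis
  show "step_functions G \<subseteq> topspace (step_topology G add \<U>)"
  proof
    fix h assume h: "h \<in> step_functions G"
    let ?B = "step_add add h ` step_nbhd G V 1"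
    have "?B \<in> step_base G add \<U>" unfolding step_base_def using h V zero_less_one by blast
    then have "openin (step_topology G add \<U>) ?B"
      unfolding openin_step_topology[OF \<U>] by (rule arbitrary_union_of_inc)
    then show "h \<in> topspace (step_topology G add \<U>)"
      using step_centre[OF h V(2), of 1] openin_subset by fastforce
  qed
qed

end

end

theory Submission
  imports Defs
begin

text \<open>Two step functions \<open>f\<close> and \<open>g\<close> are joined by the path that at time \<open>t\<close> equals \<open>g\<close> on \<open>[0,t)\<close> and
  \<open>f\<close> on \<open>[t,1)\<close>: its values at times \<open>s\<close> and \<open>t\<close> differ only on a set of measure at most
  \<open>\<bar>s - t\<bar>\<close>. The set where it leaves \<open>f \<oplus> U\<close> is contained in the set where \<open>g\<close> does, so
  every basic set \<open>f \<oplus> O(U, \<epsilon>)\<close> is star-shaped about \<open>f\<close> with respect to these paths.\<close>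

definition step_path :: "(real \<Rightarrow> 'a) \<Rightarrow> (real \<Rightarrow> 'a) \<Rightarrow> real \<Rightarrow> real \<Rightarrow> 'a" where
  "step_path f g t = (\<lambda>r\<in>J. if r < t then g r else f r)"

lemma step_functions_PiE: "f \<in> step_functions G \<Longrightarrow> f \<in> J \<rightarrow>\<^sub>E G"
  by (simp add: step_functions_def)

lemma step_functions_in: "f \<in> step_functions G \<Longrightarrow> r \<in> J \<Longrightarrow> f r \<in> G"
  using step_functions_PiE PiE_mem by metis

lemma step_path_closed:
  assumes f: "f \<in> step_functions G" and g: "g \<in> step_functions G"
  shows "step_path f g t \<in> step_functions G"
proof -
  obtain A where A: "finite A" "\<And>x y. x \<in> J \<Longrightarrow> y \<in> J \<Longrightarrow> x < y \<Longrightarrow> A \<inter> {x<..y} = {} \<Longrightarrow> f x = f y"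
    using f by (auto simp: step_functions_iff)
  obtain B where B: "finite B" "\<And>x y. x \<in> J \<Longrightarrow> y \<in> J \<Longrightarrow> x < y \<Longrightarrow> B \<inter> {x<..y} = {} \<Longrightarrow> g x = g y"
    using g by (auto simp: step_functions_iff)
  have "step_path f g t \<in> J \<rightarrow>\<^sub>E G"
    using step_functions_in[OF f] step_functions_in[OF g] by (auto simp: step_path_def)
  moreover have "step_path f g t x = step_path f g t y"
    if xy: "x \<in> J" "y \<in> J" "x < y" "insert t (A \<union> B) \<inter> {x<..y} = {}" for x y
  proof -
    \<comment> \<open>The cut \<open>r < t\<close> changes its truth value between \<open>x\<close>
      and \<open>y\<close> exactly when \<open>t\<close> lies in \<open>{x<..y}\<close>. Inserting
      \<open>t\<close> among the break points of \<open>f\<close> and \<open>g\<close> therefore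
      suffices.\<close>
    have "x < t \<longleftrightarrow> y < t" using xy by auto
    moreover have "f x = f y" "g x = g y" using A(2)[of x y] B(2)[of x y] xy by auto
    ultimately show ?thesis using xy by (simp add: step_path_def)
  qed
  moreover have "finite (insert t (A \<union> B))" using A(1) B(1) by simp
  ultimately show ?thesis unfolding step_functions_iff by (intro conjI exI[of _ "insert t (A \<union> B)"]) simp_all
qed

text \<open>Here and at time 1 the half-open \<open>J\<close> makes the endpoint exact: no
  \<open>r\<close> in \<open>J\<close> is below 0, and every one is below 1. Off \<open>J\<close>
  both sides are \<open>undefined\<close>.\<close>

lemma step_path_0: "f \<in> step_functions G \<Longrightarrow> step_path f g 0 = f"
  by (intro extensionalityI[of _ J]) (auto simp: step_path_def PiE_iff dest: step_functions_PiE)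

lemma step_path_1: "g \<in> step_functions G \<Longrightarrow> step_path f g 1 = g"
  by (intro extensionalityI[of _ J]) (auto simp: step_path_def PiE_iff dest: step_functions_PiE)

context topological_gyrogroup
begin

text \<open>Left cancellation leaves \<open>\<ominus> f r \<oplus> k r\<close> as the only possible
  value at \<open>r\<close> of a \<open>w\<close> with \<open>k = f \<oplus> w\<close>. Membership
  in a basic set thus becomes a bound on one measure, the form used in the estimates below.\<close>

lemma step_translate_nbhd_iff:
  assumes f: "f \<in> step_functions G"
  shows "k \<in> step_add add f ` step_nbhd G U \<epsilon> \<longleftrightarrow>
    k \<in> step_functions G \<and> measure lebesgue {r \<in> J. \<ominus> f r \<oplus> k r \<notin> U} < \<epsilon>"
    (is "?L \<longleftrightarrow> ?R")
proof
  assume ?L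
  then obtain w where w: "w \<in> step_functions G" "measure lebesgue {r \<in> J. w r \<notin> U} < \<epsilon>"
    and k: "k = step_add add f w"
    by (auto simp: step_nbhd_def)
  have "k \<in> step_functions G"
    unfolding k step_add_def by (rule step_map2[OF f w(1)]) (rule add_closed)
  moreover have "\<ominus> f r \<oplus> k r = w r" if "r \<in> J" for r
    using that step_functions_in[OF f] step_functions_in[OF w(1)]
    by (simp add: k step_add_def inv_add_cancel)
  then have "{r \<in> J. \<ominus> f r \<oplus> k r \<notin> U} = {r \<in> J. w r \<notin> U}" by auto
  ultimately show ?R using w(2) by simp
next
  assume k: ?R
  define w where "w = (\<lambda>r\<in>J. \<ominus> f r \<oplus> k r)"
  have "w \<in> step_functions G"
    unfolding w_def by (rule step_map2[OF f]) (use k in \<open>auto intro: add_closed inv_closed\<close>)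
  moreover have "{r \<in> J. w r \<notin> U} = {r \<in> J. \<ominus> f r \<oplus> k r \<notin> U}" by (auto simp: w_def)
  ultimately have "w \<in> step_nbhd G U \<epsilon>" using k by (simp add: step_nbhd_def)
  moreover have "k = step_add add f w"
  proof (rule extensionalityI)
    show "k \<in> extensional J" using k step_functions_PiE by (auto simp: PiE_def)
    show "step_add add f w \<in> extensional J" by (simp add: step_add_def)
    show "k r = step_add add f w r" if "r \<in> J" for r
      using that step_functions_in[OF f] step_functions_in[of k G] k
      by (simp add: step_add_def w_def add_inv_cancel)
  qed
  ultimately show ?L by simp
qed

text \<open>The pointwise difference is again a step function. Monotonicity of
  \<open>measure\<close> requires this measurability when bad sets are compared.\<close>

lemma translate_bad_lmeasurable:
  assumes f: "f \<in> step_functions G" and k: "k \<in> step_functions G"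
  shows "{r \<in> J. \<ominus> f r \<oplus> k r \<notin> U} \<in> lmeasurable"
proof -
  have "(\<lambda>r\<in>J. \<ominus> f r \<oplus> k r) \<in> step_functions G"
    by (rule step_map2[OF f k]) (intro add_closed inv_closed)
  then have "{r \<in> J. (\<lambda>r\<in>J. \<ominus> f r \<oplus> k r) r \<notin> U} \<in> lmeasurable"
    by (rule step_bad_lmeasurable)
  moreover have "{r \<in> J. (\<lambda>r\<in>J. \<ominus> f r \<oplus> k r) r \<notin> U} = {r \<in> J. \<ominus> f r \<oplus> k r \<notin> U}" by auto
  ultimately show ?thesis by simp
qed

text \<open>A basic set containing \<open>h\<close> may be centred elsewhere;
  \<open>step_base_refine\<close> recentres it at \<open>h\<close>, so that the paths starting from
  \<open>h\<close> can be used.\<close>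

lemma step_topology_local_base:
  assumes \<U>: "open_base_at T e \<U>" and W: "openin (step_topology G add \<U>) W" and h: "h \<in> W"
  obtains V \<delta> where "V \<in> \<U>" "0 < \<delta>" "step_add add h ` step_nbhd G V \<delta> \<subseteq> W"
proof -
  have "(arbitrary union_of (\<lambda>B. B \<in> step_base G add \<U>)) W"
    using W openin_step_topology[OF \<U>] by simp
  then obtain B where B: "B \<in> step_base G add \<U>" "h \<in> B" "B \<subseteq> W"
    using h by (auto simp: arbitrary_union_of_alt)
  then obtain f U \<epsilon> where *: "B = step_add add f ` step_nbhd G U \<epsilon>" "f \<in> step_functions G" "U \<in> \<U>"
    by (auto simp: step_base_def)
  have "openin T U" using \<U> *(3) by (auto simp: open_base_at_def)
  from step_base_refine[OF *(2) this \<U>, of h \<epsilon>] B(2) *(1)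
  have "\<exists>V\<in>\<U>. \<exists>\<delta>>0. step_add add h ` step_nbhd G V \<delta> \<subseteq> B" by simp
  then show thesis using that B(3) by (meson order_trans)
qed

lemma openin_step_translate_nbhd:
  assumes "open_base_at T e \<U>" "f \<in> step_functions G" "U \<in> \<U>" "0 < \<epsilon>"
  shows "openin (step_topology G add \<U>) (step_add add f ` step_nbhd G U \<epsilon>)"
  unfolding openin_step_topology[OF assms(1)]
proof (rule arbitrary_union_of_inc)
  show "step_add add f ` step_nbhd G U \<epsilon> \<in> step_base G add \<U>"
    unfolding step_base_def mem_Collect_eq
    by (intro exI[of _ f] exI[of _ U] exI[of _ \<epsilon>] conjI refl assms)
qed

lemma pathin_step_path:
  assumes \<U>: "open_base_at T e \<U>" and f: "f \<in> step_functions G" and g: "g \<in> step_functions G"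
  shows "pathin (step_topology G add \<U>) (step_path f g)"
  unfolding pathin_def continuous_map_def
proof (intro conjI allI impI)
  show "step_path f g \<in> topspace (top_of_set {0..1}) \<rightarrow> topspace (step_topology G add \<U>)"
    using step_path_closed[OF f g] topspace_step_topology[OF \<U>] by auto
next
  fix W assume W: "openin (step_topology G add \<U>) W"
  \<comment> \<open>The path is defined for every real time, so its preimage of \<open>W\<close> is
    shown open in the whole line and only then intersected with \<open>{0..1}\<close>. The measure
    bound \<open>\<delta>\<close> of a basic set centred at the value at \<open>t\<close> serves
    directly as the radius in time.\<close>
  have "\<exists>\<delta>>0. \<forall>s. \<bar>s - t\<bar> < \<delta> \<longrightarrow> step_path f g s \<in> W" if t: "step_path f g t \<in> W" for t
  proof -
    obtain V \<delta> where V: "V \<in> \<U>" "0 < \<delta>" "step_add add (step_path f g t) ` step_nbhd G V \<delta> \<subseteq> W"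
      using step_topology_local_base[OF \<U> W t] .
    have "e \<in> V" using V \<U> by (auto simp: open_base_at_def)
    have "step_path f g s \<in> W" if s: "\<bar>s - t\<bar> < \<delta>" for s
    proof -
      let ?D = "{r \<in> J. \<ominus> step_path f g t r \<oplus> step_path f g s r \<notin> V}"
      \<comment> \<open>Where the values at \<open>s\<close> and \<open>t\<close> agree, their
        difference is \<open>e\<close>, which lies in \<open>V\<close>. A bad \<open>r\<close> must
        thus lie on different sides of the cuts \<open>s\<close> and \<open>t\<close>.\<close>
      have D: "?D \<subseteq> {min s t..max s t}"
      proof
        fix r assume r: "r \<in> ?D"
        then have "step_path f g t r \<in> G"
          using step_functions_in[OF step_path_closed[OF f g]] by simp
        then have "step_path f g t r \<noteq> step_path f g s r" using r \<open>e \<in> V\<close> by (auto simp: inv_left)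
        then show "r \<in> {min s t..max s t}"
          using r by (auto simp: step_path_def split: if_splits)
      qed
      have "?D \<in> sets lebesgue"
        by (intro fmeasurableD translate_bad_lmeasurable step_path_closed f g)
      then have "measure lebesgue ?D \<le> measure lebesgue {min s t..max s t}"
        using D by (intro measure_mono_fmeasurable) auto
      also have "\<dots> < \<delta>" using s by (simp add: min_def max_def abs_if split: if_splits)
      finally show ?thesis
        using V(3) step_translate_nbhd_iff[OF step_path_closed[OF f g]]
          step_path_closed[OF f g] by blast
    qed
    then show ?thesis using V(2) by blast
  qed
  then have "open {t. step_path f g t \<in> W}"
    by (simp add: open_dist dist_real_def)
  moreover have "{t \<in> topspace (top_of_set {0..1}). step_path f g t \<in> W} = {0..1} \<inter> {t. step_path f g t \<in> W}"
    by auto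
  ultimately show "openin (top_of_set {0..1}) {t \<in> topspace (top_of_set {0..1}). step_path f g t \<in> W}"
    by (metis openin_open_Int)
qed

lemma path_connectedin_step_translate_nbhd:
  assumes \<U>: "open_base_at T e \<U>" and f: "f \<in> step_functions G" and U: "e \<in> U"
  shows "path_connectedin (step_topology G add \<U>) (step_add add f ` step_nbhd G U \<epsilon>)"
proof -
  let ?X = "step_topology G add \<U>" and ?B = "step_add add f ` step_nbhd G U \<epsilon>"
  have B: "?B \<subseteq> topspace ?X"
    using step_translate_nbhd_iff[OF f] topspace_step_topology[OF \<U>] by blast
  have "path_component_of (subtopology ?X ?B) f k" if k: "k \<in> ?B" for k
  proof -
    have ks: "k \<in> step_functions G" "measure lebesgue {r \<in> J. \<ominus> f r \<oplus> k r \<notin> U} < \<epsilon>"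
      using k step_translate_nbhd_iff[OF f] by blast+
    have "step_path f k t \<in> ?B" for t
    proof -
      have s: "step_path f k t \<in> step_functions G" by (rule step_path_closed[OF f ks(1)])
      \<comment> \<open>At each \<open>r\<close> the path takes the value of \<open>f\<close>, whose
        difference from \<open>f r\<close> is \<open>e \<in> U\<close>, or that of \<open>k\<close>.
        Hence no new bad point arises.\<close>
      have "{r \<in> J. \<ominus> f r \<oplus> step_path f k t r \<notin> U} \<subseteq> {r \<in> J. \<ominus> f r \<oplus> k r \<notin> U}"
        using step_functions_in[OF f] U by (auto simp: step_path_def inv_left split: if_splits)
      then have "measure lebesgue {r \<in> J. \<ominus> f r \<oplus> step_path f k t r \<notin> U}
          \<le> measure lebesgue {r \<in> J. \<ominus> f r \<oplus> k r \<notin> U}"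
        by (intro measure_mono_fmeasurable fmeasurableD translate_bad_lmeasurable f s ks(1))
      then show ?thesis using s ks(2) step_translate_nbhd_iff[OF f] by simp
    qed
    then have "pathin (subtopology ?X ?B) (step_path f k)"
      using pathin_step_path[OF \<U> f ks(1)] by (auto simp: pathin_subtopology)
    then show ?thesis
      unfolding path_component_of_def using step_path_0[OF f] step_path_1[OF ks(1)] by blast
  qed
  \<comment> \<open>Two points of the basic set are joined through its centre \<open>f\<close>: one
    path is reversed and the other appended.\<close>
  then have "path_connected_space (subtopology ?X ?B)"
    unfolding path_connected_space_iff_path_component
    by (metis B path_component_of_sym path_component_of_trans topspace_subtopology_subset)
  then show ?thesis using B by (simp add: path_connectedin_def)
qed

lemma path_connected_step_topology:
  assumes "open_base_at T e \<U>"
  shows "path_connected_space (step_topology G add \<U>)"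
  unfolding path_connected_space_def topspace_step_topology[OF assms]
proof (intro ballI)
  fix f g assume f: "f \<in> step_functions G" and g: "g \<in> step_functions G"
  show "\<exists>p. pathin (step_topology G add \<U>) p \<and> p 0 = f \<and> p 1 = g"
    by (intro exI[of _ "step_path f g"] conjI pathin_step_path[OF assms f g]
        step_path_0[OF f] step_path_1[OF g])
qed

lemma locally_path_connected_step_topology:
  assumes \<U>: "open_base_at T e \<U>"
  shows "locally_path_connected_space (step_topology G add \<U>)"
  unfolding locally_path_connected_space_def neighbourhood_base_of
proof (intro allI impI)
  fix W h assume W: "openin (step_topology G add \<U>) W \<and> h \<in> W"
  then obtain V \<delta> where V: "V \<in> \<U>" "0 < \<delta>" "step_add add h ` step_nbhd G V \<delta> \<subseteq> W"
    using step_topology_local_base[OF \<U>] by blast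
  have h: "h \<in> step_functions G"
    using W openin_subset topspace_step_topology[OF \<U>] by blast
  have e: "e \<in> V" using \<U> V(1) by (auto simp: open_base_at_def)
  show "\<exists>A B. openin (step_topology G add \<U>) A \<and> path_connectedin (step_topology G add \<U>) B \<and>
      h \<in> A \<and> A \<subseteq> B \<and> B \<subseteq> W"
    \<comment> \<open>The same basic set is both the open \<open>A\<close> and the path-connected
      \<open>B\<close>.\<close>
    by (intro exI[of _ "step_add add h ` step_nbhd G V \<delta>"] conjI
        openin_step_translate_nbhd[OF \<U> h V(1,2)] V(3) order_refl
        path_connectedin_step_translate_nbhd[OF \<U> h e] step_centre[OF h e V(2)])
qed

end

theorem theorem3p2:
  fixes G :: "'a set"
    and add :: "'a \<Rightarrow> 'a \<Rightarrow> 'a"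
    and e :: 'a
    and inv :: "'a \<Rightarrow> 'a"
    and gyr :: "'a \<Rightarrow> 'a \<Rightarrow> 'a \<Rightarrow> 'a"
    and T :: "'a topology"
    and \<U> :: "'a set set"
  assumes "topological_gyrogroup G add e inv gyr T"
    and "open_base_at T e \<U>"
  shows "path_connected_space (step_topology G add \<U>) \<and>
         locally_path_connected_space (step_topology G add \<U>)"
  using topological_gyrogroup.path_connected_step_topology[OF assms]
    topological_gyrogroup.locally_path_connected_step_topology[OF assms] by blast

end
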